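(* If $G$ is a torsion-free group, then $G$ has a Lee metric if and only if $G$ is cyclic.
   Context: All metrics on groups are integral (integer valued) and right translation invariant: $d(gh,g'h)=d(g,g')$ for all $g,g',h\in G$. The weight of $d$ is $w(x)=d(x,e)$, $e$ the identity of $G$. The partition induced by $d$, denoted $P(G,d)$, is the set of classes of the equivalence relation $g\sim h\Leftrightarrow w(g)=w(h)$. Such a metric is gapless if the set of values of $w$ is exactly $\{0,1,\ldots,n\}$ when $P(G,d)$ has finitely many parts, $n$ of them different from $\{e\}$, and is exactly $\mathbb{N}_0=\{0,1,2,\ldots\}$ when $P(G,d)$ has infinitely many parts. The Lee partition of $G$ is $\mathcal{P}_{Lee}(G)=\{\{a,a^{-1}\}:a\in G\}$. A Lee metric on $G$ is a gapless metric $d$ on $G$ with $P(G,d)=\mathcal{P}_{Lee}(G)$. *)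

theory Defs
  imports "HOL-Algebra.Elementary_Groups" "HOL-Analysis.Abstract_Metric_Spaces"
begin

definition torsion_free :: "('a, 'b) monoid_scheme \<Rightarrow> bool" where
  "torsion_free G \<longleftrightarrow>
     (\<forall>x\<in>carrier G. \<forall>n::nat. n > 0 \<longrightarrow> x [^]\<^bsub>G\<^esub> n = \<one>\<^bsub>G\<^esub> \<longrightarrow> x = \<one>\<^bsub>G\<^esub>)"

text \<open>Metrics on groups are real-valued, as in the locale \<^locale>\<open>Metric_space\<close>, but restricted
  to integer values and right translation invariant.\<close>

definition group_metric :: "('a, 'b) monoid_scheme \<Rightarrow> ('a \<Rightarrow> 'a \<Rightarrow> real) \<Rightarrow> bool" where
  "group_metric G d \<longleftrightarrow>
     Metric_space (carrier G) d \<and>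
     (\<forall>x\<in>carrier G. \<forall>y\<in>carrier G. d x y \<in> \<int>) \<and>
     (\<forall>g\<in>carrier G. \<forall>g'\<in>carrier G. \<forall>h\<in>carrier G.
        d (g \<otimes>\<^bsub>G\<^esub> h) (g' \<otimes>\<^bsub>G\<^esub> h) = d g g')"

definition weight :: "('a, 'b) monoid_scheme \<Rightarrow> ('a \<Rightarrow> 'a \<Rightarrow> real) \<Rightarrow> 'a \<Rightarrow> real" where
  "weight G d x = d x \<one>\<^bsub>G\<^esub>"

definition weight_partition :: "('a, 'b) monoid_scheme \<Rightarrow> ('a \<Rightarrow> 'a \<Rightarrow> real) \<Rightarrow> 'a set set" where
  "weight_partition G d =
     carrier G // {(g, h). g \<in> carrier G \<and> h \<in> carrier G \<and> weight G d g = weight G d h}"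

definition gapless :: "('a, 'b) monoid_scheme \<Rightarrow> ('a \<Rightarrow> 'a \<Rightarrow> real) \<Rightarrow> bool" where
  "gapless G d \<longleftrightarrow>
     weight G d ` carrier G =
       (if finite (weight_partition G d)
        then real ` {0..card (weight_partition G d - {{\<one>\<^bsub>G\<^esub>}})}
        else \<nat>)"

definition lee_partition :: "('a, 'b) monoid_scheme \<Rightarrow> 'a set set" where
  "lee_partition G = {{a, inv\<^bsub>G\<^esub> a} | a. a \<in> carrier G}"

definition lee_metric :: "('a, 'b) monoid_scheme \<Rightarrow> ('a \<Rightarrow> 'a \<Rightarrow> real) \<Rightarrow> bool" where
  "lee_metric G d \<longleftrightarrow>
     group_metric G d \<and> gapless G d \<and> weight_partition G d = lee_partition G"

end

theory Submission
  imports Defs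
begin

text \<open>If a Lee metric exists and the group is nontrivial, gaplessness supplies an element \<open>a\<close> of
  weight 1, and subadditivity gives \<open>w(a^n) \<le> n\<close>. Since weights separate elements up to inversion
  and the powers of \<open>a\<close> are distinct, \<open>w(a^n)\<close> cannot be a value already taken by a smaller power,
  so by induction \<open>w(a^n) = n\<close>. Hence an element of weight \<open>n\<close> is \<open>a^n\<close> or its inverse.
  Conversely, an isomorphism onto the integers (or the trivial map, if the group is trivial) pulls
  back the absolute value metric.\<close>

context group
begin

text \<open>The weight class of \<open>x\<close> is a part of the Lee partition, hence some
  \<open>{b, inv b}\<close>. Both \<open>x\<close> and \<open>y\<close> lie in it, and two members
  of such a pair are equal or mutually inverse.\<close>

lemma mem_weight_class:
  assumes "weight_partition G d = lee_partition G"
    and "x \<in> carrier G" "y \<in> carrier G" "weight G d x = weight G d y"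
  shows "y = x \<or> y = inv x"
proof -
  let ?r = "{(g, h). g \<in> carrier G \<and> h \<in> carrier G \<and> weight G d g = weight G d h}"
  have "?r `` {x} \<in> weight_partition G d"
    using assms(2) unfolding weight_partition_def by (rule quotientI)
  then obtain b where b: "b \<in> carrier G" "?r `` {x} = {b, inv b}"
    using assms(1) unfolding lee_partition_def by auto
  have "x \<in> ?r `` {x}" "y \<in> ?r `` {x}"
    using assms by auto
  then show ?thesis
    unfolding b(2) using b(1) by auto
qed

lemma weight_one:
  assumes "group_metric G d"
  shows "weight G d \<one> = 0"
  using assms Metric_space.mdist_zero one_closed unfolding group_metric_def weight_def by metis

text \<open>Apply the triangle inequality through \<open>y\<close>: by right invariance the leg from
  \<open>x \<otimes> y\<close> to \<open>y\<close> is as long as the one from \<open>x\<close> to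
  the identity.\<close>

lemma weight_mult_le:
  assumes "group_metric G d" "x \<in> carrier G" "y \<in> carrier G"
  shows "weight G d (x \<otimes> y) \<le> weight G d x + weight G d y"
proof -
  interpret Metric_space "carrier G" d
    using assms(1) by (simp add: group_metric_def)
  have "d (x \<otimes> y) (\<one> \<otimes> y) = d x \<one>"
    using assms unfolding group_metric_def by blast
  then show ?thesis
    using triangle[of "x \<otimes> y" y \<one>] assms(2,3) by (simp add: weight_def)
qed

lemma weight_eq_nat:
  assumes "group_metric G d" "x \<in> carrier G"
  obtains n :: nat where "weight G d x = real n"
proof -
  interpret Metric_space "carrier G" d
    using assms(1) by (simp add: group_metric_def)
  have "weight G d x \<in> \<int>" "weight G d x \<ge> 0"
    using assms by (auto simp: weight_def group_metric_def)
  then have "weight G d x \<in> \<nat>"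
    by (simp add: Nats_altdef2)
  then show ?thesis
    using that by (auto elim: Nats_cases)
qed

lemma torsion_free_int_pow_inj:
  assumes "torsion_free G" "x \<in> carrier G" "x \<noteq> \<one>" "x [^] (i::int) = x [^] (j::int)"
  shows "i = j"
proof (rule ccontr)
  assume ne: "i \<noteq> j"
  have "x [^] k \<noteq> \<one>" if "k > 0" for k :: int
  proof -
    have "x [^] nat k \<noteq> \<one>"
      using assms(1-3) that unfolding torsion_free_def by (metis zero_less_nat_eq)
    then show ?thesis
      using that int_pow_int[of G x "nat k"] by simp
  qed
  \<comment> \<open>Both differences are taken because one of them is positive, which contradicts
    the previous fact.\<close>
  moreover have "x [^] (i - j) = \<one>" "x [^] (j - i) = \<one>"
    using assms(2,4) by (simp_all add: int_pow_diff)
  ultimately show False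
    using ne by (meson diff_gt_0_iff_gt linorder_neqE)
qed

lemma lee_metric_weight_pow:
  assumes "torsion_free G" "lee_metric G d"
    and a: "a \<in> carrier G" "weight G d a = 1"
  shows "weight G d (a [^] (n::nat)) = real n"
proof (induction n rule: less_induct)
  case (less n)
  have gm: "group_metric G d" and part: "weight_partition G d = lee_partition G"
    using assms(2) by (auto simp: lee_metric_def)
  have "a \<noteq> \<one>"
    using a weight_one[OF gm] by auto
  note inj = torsion_free_int_pow_inj[OF assms(1) a(1) this]
  obtain m where m: "weight G d (a [^] n) = real m"
    using weight_eq_nat[OF gm] a(1) by blast
  have "m \<le> n"
  proof (cases n)
    case 0
    then show ?thesis
      using m weight_one[OF gm] by simp
  next
    case (Suc k)
    then show ?thesis
      using m less[of k] weight_mult_le[OF gm, of "a [^] k" a] a by simp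
  qed
  moreover have "\<not> m < n"
  proof
    assume "m < n"
    with less m have "weight G d (a [^] m) = weight G d (a [^] n)"
      by simp
    then have "a [^] n = a [^] m \<or> a [^] n = inv (a [^] m)"
      using a(1) part by (intro mem_weight_class) auto
    \<comment> \<open>With integer exponents both alternatives compare powers of \<open>a\<close>,
      so injectivity gives n = m or n = -m. Neither is possible when 0 \<le> m < n.\<close>
    then have "a [^] int n = a [^] int m \<or> a [^] int n = a [^] (- int m)"
      using a(1) by (simp add: int_pow_int int_pow_neg)
    then show False
      using inj \<open>m < n\<close> by fastforce
  qed
  ultimately show ?case
    using m by simp
qed

lemma lee_metric_obtain_weight_one:
  assumes "lee_metric G d" "carrier G \<noteq> {\<one>}"
  obtains a where "a \<in> carrier G" "weight G d a = 1"
proof -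
  obtain x where "x \<in> carrier G" "x \<noteq> \<one>"
    using assms(2) one_closed by blast
  \<comment> \<open>This part differs from the class of the identity, so if there are finitely many
    parts, the top weight prescribed by gaplessness is at least 1.\<close>
  then have ne: "{x, inv x} \<in> weight_partition G d - {{\<one>}}"
    using assms(1) unfolding lee_metric_def lee_partition_def by blast
  have "1 \<in> weight G d ` carrier G"
  proof (cases "finite (weight_partition G d)")
    case True
    then have "1 \<le> card (weight_partition G d - {{\<one>}})"
      using ne by (metis One_nat_def Suc_leI card_gt_0_iff empty_iff finite_Diff)
    then have "real 1 \<in> real ` {0..card (weight_partition G d - {{\<one>}})}"
      by (intro imageI) simp
    then show ?thesis
      using assms(1) True unfolding lee_metric_def gapless_def by (metis of_nat_1)
  next
    case False
    then show ?thesis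
      using assms(1) by (simp add: lee_metric_def gapless_def)
  qed
  then show ?thesis
    using that by auto
qed

lemma lee_metric_imp_cyclic:
  assumes "torsion_free G" "lee_metric G d"
  shows "cyclic_group G"
proof (cases "carrier G = {\<one>}")
  case True
  then show ?thesis
    by (simp add: trivial_imp_cyclic_group trivial_group_def is_group)
next
  case False
  then obtain a where a: "a \<in> carrier G" "weight G d a = 1"
    using lee_metric_obtain_weight_one[OF assms(2)] by blast
  have gm: "group_metric G d" and part: "weight_partition G d = lee_partition G"
    using assms(2) by (auto simp: lee_metric_def)
  have "\<exists>k::int. x = a [^] k" if x: "x \<in> carrier G" for x
  proof -
    obtain n where "weight G d x = real n"
      using weight_eq_nat[OF gm x] .
    then have "weight G d (a [^] n) = weight G d x"
      using lee_metric_weight_pow[OF assms a] by simp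
    then have "x = a [^] n \<or> x = inv (a [^] n)"
      using a(1) x part by (intro mem_weight_class) auto
    then have "x = a [^] int n \<or> x = a [^] (- int n)"
      using a(1) by (simp add: int_pow_int int_pow_neg)
    then show ?thesis
      by blast
  qed
  then show ?thesis
    unfolding cyclic_group using a(1) by blast
qed

text \<open>Pulls back the distance on the integers along an injective homomorphism
  \<open>k\<close>. The disjunction \<open>im\<close> covers the infinite cyclic and the trivial
  group at once and serves gaplessness: an image consisting of the multiples of some m > 1 would
  leave gaps between the weights.\<close>

lemma lee_metric_of_int_hom:
  fixes k :: "'a \<Rightarrow> int"
  assumes hom: "\<And>x y. x \<in> carrier G \<Longrightarrow> y \<in> carrier G \<Longrightarrow> k (x \<otimes> y) = k x + k y"
    and inj: "inj_on k (carrier G)"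
    and im: "k ` carrier G = UNIV \<or> carrier G = {\<one>}"
  shows "lee_metric G (\<lambda>x y. \<bar>of_int (k x - k y)\<bar>)"
proof -
  let ?d = "\<lambda>x y. \<bar>of_int (k x - k y)\<bar> :: real"
  have k1: "k \<one> = 0"
    using hom[of \<one> \<one>] by simp
  have kinv: "k (inv x) = - k x" if "x \<in> carrier G" for x
    using hom[of x "inv x"] that k1 by simp
  have w: "weight G ?d x = of_int \<bar>k x\<bar>" for x
    by (simp add: weight_def k1)
  have "Metric_space (carrier G) ?d"
    using inj by unfold_locales (auto simp: inj_on_def)
  then have gm: "group_metric G ?d"
    by (auto simp: group_metric_def hom)
  have cls: "{(g, h). g \<in> carrier G \<and> h \<in> carrier G \<and> weight G ?d g = weight G ?d h} `` {x}
      = {x, inv x}" if x: "x \<in> carrier G" for x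
  proof -
    \<comment> \<open>Equal absolute values mean that \<open>k y\<close> is \<open>k x\<close> or
      \<open>- k x\<close>, the latter being \<open>k (inv x)\<close>; injectivity of
      \<open>k\<close> does the rest.\<close>
    have "y = x \<or> y = inv x" if y: "y \<in> carrier G" "\<bar>k x\<bar> = \<bar>k y\<bar>" for y
    proof -
      have "k y = k x \<or> k y = k (inv x)"
        using y(2) kinv[OF x] by linarith
      then show ?thesis
        using inj x y(1) by (meson inj_onD inv_closed)
    qed
    moreover have "\<bar>k (inv x)\<bar> = \<bar>k x\<bar>"
      by (simp add: kinv[OF x])
    ultimately show ?thesis
      unfolding w of_int_eq_iff using x by auto
  qed
  have part: "weight_partition G ?d = lee_partition G"
  proof -
    have "weight_partition G ?d = (\<Union>x\<in>carrier G. {{x, inv x}})"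
      unfolding weight_partition_def quotient_def by (intro SUP_cong refl) (simp only: cls)
    then show ?thesis
      by (auto simp: lee_partition_def)
  qed
  have "gapless G ?d"
  proof (cases "carrier G = {\<one>}")
    case True
    \<comment> \<open>No part remains once the class of the identity is removed, so the prescribed
      set of weights is \<open>{0..0}\<close>.\<close>
    have "weight_partition G ?d = {{\<one>}}"
      unfolding part lee_partition_def True by simp
    moreover have "weight G ?d ` carrier G = {0}"
      unfolding True image_insert image_empty w k1 by simp
    ultimately show ?thesis
      by (simp add: gapless_def)
  next
    case False
    with im have im: "k ` carrier G = UNIV"
      by blast
    have "weight G ?d ` carrier G = (\<lambda>i. of_int \<bar>i\<bar>) ` k ` carrier G"
      unfolding image_image by (intro image_cong refl w)
    also have "\<dots> = \<nat>"
      unfolding im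
    proof (intro subset_antisym subsetI)
      fix x :: real
      assume "x \<in> range (\<lambda>i. of_int \<bar>i\<bar>)"
      then obtain i where "x = of_int \<bar>i\<bar>"
        by blast
      then show "x \<in> \<nat>"
        by (simp add: Nats_altdef2)
    next
      fix x :: real
      assume "x \<in> \<nat>"
      then obtain n where "x = real n"
        by (auto elim: Nats_cases)
      then have "x = of_int \<bar>int n\<bar>"
        by simp
      then show "x \<in> range (\<lambda>i. of_int \<bar>i\<bar>)"
        by blast
    qed
    finally have "weight G ?d ` carrier G = \<nat>" .
    \<comment> \<open>The parts cover the carrier and have at most two elements each, so finitely
      many of them would make the carrier finite, although \<open>k\<close> maps it onto the
      integers.\<close>
    moreover have "infinite (weight_partition G ?d)"
    proof
      assume "finite (weight_partition G ?d)"
      moreover have "carrier G \<subseteq> \<Union> (weight_partition G ?d)"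
        unfolding part lee_partition_def by blast
      moreover have "\<forall>P \<in> weight_partition G ?d. finite P"
        unfolding part lee_partition_def by auto
      ultimately have "finite (carrier G)"
        by (meson finite_Union finite_subset)
      then have "finite (k ` carrier G)"
        by simp
      then show False
        by (simp add: im infinite_UNIV_int)
    qed
    ultimately show ?thesis
      by (simp add: gapless_def)
  qed
  with gm part show ?thesis
    by (simp add: lee_metric_def)
qed

lemma cyclic_imp_lee_metric:
  assumes "torsion_free G" "cyclic_group G"
  shows "\<exists>d. lee_metric G d"
proof (cases "carrier G = {\<one>}")
  case True
  then show ?thesis
    \<comment> \<open>On a one-element carrier even the zero map is injective.\<close>
    using lee_metric_of_int_hom[of "\<lambda>_. 0"] by auto
next
  case False
  obtain a where a: "a \<in> carrier G" and gen: "carrier G = range (\<lambda>n::int. a [^] n)"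
    using assms(2) unfolding cyclic_group by auto
  have "a \<noteq> \<one>"
    using False gen by auto
  note inj = torsion_free_int_pow_inj[OF assms(1) a this]
  \<comment> \<open>The discrete logarithm to base \<open>a\<close>: it is well determined since
    distinct exponents give distinct powers, and the exponent laws make it a homomorphism.\<close>
  define k where "k = inv_into UNIV (\<lambda>n::int. a [^] n)"
  have k: "k (a [^] n) = n" for n :: int
    unfolding k_def using inj by (intro inv_into_f_f injI) auto
  have "lee_metric G (\<lambda>x y. \<bar>of_int (k x - k y)\<bar>)"
  proof (rule lee_metric_of_int_hom)
    show "k (x \<otimes> y) = k x + k y" if xy: "x \<in> carrier G" "y \<in> carrier G" for x y
    proof -
      obtain i j :: int where "x = a [^] i" "y = a [^] j"
        using xy unfolding gen by blast
      then show ?thesis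
        using a by (simp add: k int_pow_mult[symmetric])
    qed
    show "inj_on k (carrier G)"
      unfolding gen by (auto simp: inj_on_def k)
    show "k ` carrier G = UNIV \<or> carrier G = {\<one>}"
      unfolding gen by (simp add: image_image k)
  qed
  then show ?thesis
    by blast
qed

end

theorem corollary4p4:
  fixes G :: "('a, 'b) monoid_scheme"
  assumes "group G" and "torsion_free G"
  shows "(\<exists>d. lee_metric G d) \<longleftrightarrow> cyclic_group G"
  using group.lee_metric_imp_cyclic group.cyclic_imp_lee_metric assms by metis

end
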